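(* Let $\mathfrak p\subset A=\mathbb F_q[T]$ be a nonzero prime ideal, $d=\deg_T(\mathfrak p)$, and let $\phi$ be a supersingular Drinfeld module of rank $r\ge2$ over $\overline{\mathbb F}_{\mathfrak p}$, where $\mathbb F_{\mathfrak p}=A/\mathfrak p$. Let $\mathfrak q_1,\dots,\mathfrak q_\ell\in A$ be distinct monic irreducible polynomials of degree $m$, different from $\mathfrak p$; let $1\le t\le\ell r$ be an integer, $s=tm-1$, with $tm-1\ge\frac{r^2(r-1)(d-1)}2$. For $i=1,\dots,\ell$ let $\rho_i:\operatorname{End}(\phi)\to\operatorname{End}_{A/(\mathfrak q_i)}(\phi[\mathfrak q_i])\cong\operatorname{Mat}_{r\times r}(\mathbb F_{q^m})$ be restriction to $\mathfrak q_i$-torsion. Let $u\in M_s(\phi)$, $E_i\in\operatorname{Mat}_{r\times r}(\mathbb F_{q^m})$, and $Y_i=\rho_i(u)+E_i$ for $i=1,\dots,\ell$. Let $\varepsilon\in\mathbb Z_{\ge0}$ and suppose that $\lambda\in\mathbb Z_{\ge0}$ satisfies $$\dim_{\mathbb F_q}M_\lambda(\phi)>mr\varepsilon,\qquad \lambda+s<m(\ell r-\varepsilon).$$ If $\sum_{i}\operatorname{rk}_{\mathbb F_{q^m}}(E_i)\le\varepsilon$, then the linear equations $$\rho_i(v)Y_i=\rho_i(N),\qquad i=1,\dots,\ell,$$ have a nonzero solution $(v,N)\in M_\lambda(\phi)\times M_{\lambda+s}(\phi)$, and every nonzero solution $(v,N)\in M_\lambda(\phi)\times M_{\lambda+s}(\phi)$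 satisfies $N=vu$. In particular, for every nonzero solution, $v\ne0$ and $u$ is the right quotient in the identity $N=vu$.
   Context: $q$ is a prime power, $A=\mathbb F_q[T]$. The same symbol is used for a nonzero ideal of $A$ and its monic generator. The field $k=\overline{\mathbb F}_{\mathfrak p}$ is an $A$-field via $\gamma:A\to A/\mathfrak p\hookrightarrow k$. The twisted polynomial ring $k\{\tau\}$ consists of polynomials $\sum a_i\tau^i$ with $(a\tau^i)(b\tau^j)=ab^{q^i}\tau^{i+j}$; an element acts on $\overline k$ by $\sum a_i\tau^i: x\mapsto\sum a_i x^{q^i}$, and multiplication corresponds to composition. A Drinfeld module of rank $r$ over $k$ is an $\mathbb F_q$-algebra homomorphism $\phi:A\to k\{\tau\}$, $a\mapsto\phi_a$, with $\phi_T=\gamma(T)+g_1\tau+\dots+g_r\tau^r$, $g_r\neq 0$. Its height $h$ ($1\le h\le r$) is defined by: the lowest nonzero term of $\phi_{\mathfrak p}$ has $\tau$-degree $hd$; $\phi$ is supersingular if $h=r$. $\operatorname{End}(\phi)=\{u\in\overline k\{\tau\}: u\phi_a=\phi_a u\ \forall a\in A\}$, and for an integer $n\ge0$, $M_n(\phi)=\{0\}\cup\{u\in\operatorname{End}(\phi):u\ne0,\ \deg_\tau(u)\le n\}$, an $\mathbb F_q$-vector space. For $a\in A$ nonzero, $\phi[a]=\{\alpha\in\overline k:\phi_a(\alpha)=0\}$, an $A$-module via $b\cdot\alpha=\phi_b(\alpha)$. Since $\mathfrak q_i$ is prime to $\mathfrak p$, $\phi[\mathfrak q_i]\cong(A/\mathfrak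 q_i)^r\cong\mathbb F_{q^m}^r$; endomorphisms of $\phi$ act $A/\mathfrak q_i$-linearly on it, and isomorphisms $A/\mathfrak q_i\cong\mathbb F_{q^m}$ and bases of $\phi[\mathfrak q_i]$ are fixed to identify $\operatorname{End}_{A/(\mathfrak q_i)}(\phi[\mathfrak q_i])$ with $\operatorname{Mat}_{r\times r}(\mathbb F_{q^m})$ (matrix product = composition). *)

theory Defs
  imports
    "HOL-Algebra.Algebraic_Closure_Type"
    "HOL-Computational_Algebra.Computational_Algebra"
    "HOL-Analysis.Analysis"
begin

text \<open>
  Conventions: the type \<open>'f\<close> is the field with \<open>q = CARD('f)\<close> elements and \<open>'f poly\<close> is
  \<open>A = F_q[T]\<close>. There is no quotient type for \<open>A/Q\<close>; it is presented by a field type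
  together with a surjective ring homomorphism from \<open>A\<close> whose kernel is generated by \<open>Q\<close>.
\<close>

definition residue_map :: "'f::field poly \<Rightarrow> ('f poly \<Rightarrow> 'e::field) \<Rightarrow> bool" where
  "residue_map Q \<pi> \<longleftrightarrow>
     \<pi> 1 = 1 \<and> (\<forall>a b. \<pi> (a + b) = \<pi> a + \<pi> b) \<and> (\<forall>a b. \<pi> (a * b) = \<pi> a * \<pi> b) \<and>
     surj \<pi> \<and> (\<forall>a. \<pi> a = 0 \<longleftrightarrow> Q dvd a)"


text \<open>
  An element \<open>\<Sum> a\<^sub>i \<tau>\<^sup>i\<close> of \<open>k{\<tau>}\<close> is stored as the ordinary polynomial with coefficients
  \<open>a\<^sub>i\<close>. Addition, left multiplication by constants (\<open>smult\<close>) and \<open>\<tau>\<close>-degree (\<open>degree\<close>)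
  are those of ordinary polynomials, but multiplication is \<open>skew_mult\<close> and never \<open>*\<close>.
\<close>

type_synonym 'k skew_poly = "'k poly"

definition skew_mult :: "nat \<Rightarrow> 'k::field skew_poly \<Rightarrow> 'k skew_poly \<Rightarrow> 'k skew_poly" where
  "skew_mult q f g =
     (\<Sum>i\<le>Polynomial.degree f. \<Sum>j\<le>Polynomial.degree g.
        Polynomial.monom (Polynomial.coeff f i * Polynomial.coeff g j ^ (q ^ i)) (i + j))"

definition skew_eval :: "nat \<Rightarrow> 'k::field skew_poly \<Rightarrow> 'k \<Rightarrow> 'k" where
  "skew_eval q f x = (\<Sum>i\<le>Polynomial.degree f. Polynomial.coeff f i * x ^ (q ^ i))"


text \<open>
  \<open>\<gamma>\<close> is the structure map of the \<open>A\<close>-field \<open>k\<close>. The third conjunct says that the ring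
  homomorphism \<open>\<phi>\<close> is \<open>F_q\<close>-linear (and in particular unital).
\<close>

definition drinfeld_module ::
  "('f::{field,finite} poly \<Rightarrow> 'k::field) \<Rightarrow> nat \<Rightarrow> ('f poly \<Rightarrow> 'k skew_poly) \<Rightarrow> bool" where
  "drinfeld_module \<gamma> r \<phi> \<longleftrightarrow>
     (\<forall>a b. \<phi> (a + b) = \<phi> a + \<phi> b) \<and>
     (\<forall>a b. \<phi> (a * b) = skew_mult CARD('f) (\<phi> a) (\<phi> b)) \<and>
     (\<forall>c. \<phi> [:c:] = [:\<gamma> [:c:]:]) \<and>
     Polynomial.coeff (\<phi> [:0, 1:]) 0 = \<gamma> [:0, 1:] \<and>
     Polynomial.degree (\<phi> [:0, 1:]) = r \<and> 1 \<le> r"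

definition has_height :: "'f::{field,finite} poly \<Rightarrow> ('f poly \<Rightarrow> 'k::field skew_poly) \<Rightarrow> nat \<Rightarrow> bool" where
  "has_height P \<phi> h \<longleftrightarrow>
     (LEAST i. Polynomial.coeff (\<phi> P) i \<noteq> 0) = h * Polynomial.degree P"

definition supersingular ::
  "'f::{field,finite} poly \<Rightarrow> nat \<Rightarrow> ('f poly \<Rightarrow> 'k::field skew_poly) \<Rightarrow> bool" where
  "supersingular P r \<phi> \<longleftrightarrow> has_height P \<phi> r"

text \<open>For \<open>k\<close> algebraically closed, as below, endomorphisms over an algebraic closure of \<open>k\<close>
  and over \<open>k\<close> are the same.\<close>

definition drinfeld_End ::
  "('f::{field,finite} poly \<Rightarrow> 'k::alg_closed_field skew_poly) \<Rightarrow> 'k skew_poly set" where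
  "drinfeld_End \<phi> =
     {u. \<forall>a. skew_mult CARD('f) u (\<phi> a) = skew_mult CARD('f) (\<phi> a) u}"

definition bounded_End ::
  "('f::{field,finite} poly \<Rightarrow> 'k::alg_closed_field skew_poly) \<Rightarrow> nat \<Rightarrow> 'k skew_poly set" where
  "bounded_End \<phi> n = {0} \<union> {u \<in> drinfeld_End \<phi>. u \<noteq> 0 \<and> Polynomial.degree u \<le> n}"

definition Fq_scale :: "('f::field poly \<Rightarrow> 'k::field) \<Rightarrow> 'f \<Rightarrow> 'k skew_poly \<Rightarrow> 'k skew_poly" where
  "Fq_scale \<gamma> c u = smult (\<gamma> [:c:]) u"

abbreviation Fq_dim :: "('f::field poly \<Rightarrow> 'k::field) \<Rightarrow> 'k skew_poly set \<Rightarrow> nat" where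
  "Fq_dim \<gamma> V \<equiv> vector_space.dim (Fq_scale \<gamma>) V"

definition torsion ::
  "('f::{field,finite} poly \<Rightarrow> 'k::alg_closed_field skew_poly) \<Rightarrow> 'f poly \<Rightarrow> 'k set" where
  "torsion \<phi> a = {\<alpha>. skew_eval CARD('f) (\<phi> a) \<alpha> = 0}"

text \<open>
  Let \<open>residue_map Q \<pi>\<close>. Then \<open>tors_scale \<phi> \<pi>\<close> is the action of \<open>A/Q\<close>, identified with \<open>'e\<close>
  through \<open>\<pi>\<close>, on \<open>torsion \<phi> Q\<close>; on that set it does not depend on the chosen representative.
\<close>

definition tors_scale ::
  "('f::{field,finite} poly \<Rightarrow> 'k::alg_closed_field skew_poly) \<Rightarrow> ('f poly \<Rightarrow> 'e::field) \<Rightarrow>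
   'e \<Rightarrow> 'k \<Rightarrow> 'k" where
  "tors_scale \<phi> \<pi> x \<alpha> = skew_eval CARD('f) (\<phi> (SOME a. \<pi> a = x)) \<alpha>"

definition tors_lincomb ::
  "('f::{field,finite} poly \<Rightarrow> 'k::alg_closed_field skew_poly) \<Rightarrow> ('f poly \<Rightarrow> 'e::field) \<Rightarrow>
   ('n::finite \<Rightarrow> 'k) \<Rightarrow> 'e ^ 'n \<Rightarrow> 'k" where
  "tors_lincomb \<phi> \<pi> b c = (\<Sum>j\<in>UNIV. tors_scale \<phi> \<pi> (c $ j) (b j))"

definition torsion_basis ::
  "('f::{field,finite} poly \<Rightarrow> 'k::alg_closed_field skew_poly) \<Rightarrow> 'f poly \<Rightarrow>
   ('f poly \<Rightarrow> 'e::field) \<Rightarrow> ('n::finite \<Rightarrow> 'k) \<Rightarrow> bool" where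
  "torsion_basis \<phi> Q \<pi> b \<longleftrightarrow>
     (\<forall>j. b j \<in> torsion \<phi> Q) \<and>
     (\<forall>c. tors_lincomb \<phi> \<pi> b c = 0 \<longrightarrow> c = 0) \<and>
     (\<forall>\<alpha>\<in>torsion \<phi> Q. \<exists>c. \<alpha> = tors_lincomb \<phi> \<pi> b c)"

definition tors_coords ::
  "('f::{field,finite} poly \<Rightarrow> 'k::alg_closed_field skew_poly) \<Rightarrow> ('f poly \<Rightarrow> 'e::field) \<Rightarrow>
   ('n::finite \<Rightarrow> 'k) \<Rightarrow> 'k \<Rightarrow> 'e ^ 'n" where
  "tors_coords \<phi> \<pi> b \<alpha> = (THE c. tors_lincomb \<phi> \<pi> b c = \<alpha>)"

text \<open>
  The matrix of the restriction of \<open>u\<close> to the torsion: column \<open>j\<close> holds the coordinates of the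
  image of \<open>b j\<close>, so that the matrix product corresponds to composition.
\<close>

definition tors_rep ::
  "('f::{field,finite} poly \<Rightarrow> 'k::alg_closed_field skew_poly) \<Rightarrow> ('f poly \<Rightarrow> 'e::field) \<Rightarrow>
   ('n::finite \<Rightarrow> 'k) \<Rightarrow> 'k skew_poly \<Rightarrow> 'e ^ 'n ^ 'n" where
  "tors_rep \<phi> \<pi> b u = (\<chi> i j. tors_coords \<phi> \<pi> b (skew_eval CARD('f) u (b j)) $ i)"

definition is_right_quotient ::
  "nat \<Rightarrow> 'k::field skew_poly \<Rightarrow> 'k skew_poly \<Rightarrow> 'k skew_poly \<Rightarrow> bool" where
  "is_right_quotient q N v u \<longleftrightarrow>
     N = skew_mult q v u \<and> (\<forall>w. N = skew_mult q v w \<longrightarrow> w = u)"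

end

theory Submission
  imports Defs
begin

text \<open>
  For a solution \<open>(v, N)\<close> put \<open>w = N - vu\<close>. Then \<open>\<rho>\<^sub>i(w) = \<rho>\<^sub>i(v) E\<^sub>i\<close> vanishes on \<open>ker E\<^sub>i\<close>, so \<open>w\<close>
  kills at least \<open>q\<^sup>n\<close> points of \<open>\<phi>[q\<^sub>1] \<oplus> \<dots> \<oplus> \<phi>[q\<^sub>l]\<close> with \<open>n = m(lr - \<epsilon>)\<close>; since a nonzero
  \<open>w\<close> has at most \<open>q\<^bsup>deg w\<^esup>\<close> roots, the degree bound gives \<open>w = 0\<close>. Conversely
  \<open>(v, vu)\<close> is a solution as soon as \<open>\<rho>\<^sub>i(v) E\<^sub>i = 0\<close> for all \<open>i\<close>, and since the tuple
  \<open>(\<rho>\<^sub>i(v) E\<^sub>i)\<^sub>i\<close> takes at most \<open>q\<^bsup>mr\<epsilon>\<^esup>\<close> values, the pigeonhole principle provides such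
  a nonzero \<open>v\<close>.
\<close>

unbundle no fps_syntax

section \<open>Counting over finite fields\<close>

lemma card_UNIV_field_gt_1:
  assumes "finite (UNIV :: 'f::field set)"
  shows "CARD('f) > 1"
proof -
  have "card {0, 1::'f} \<le> CARD('f)" by (intro card_mono assms) simp
  then show ?thesis by simp
qed

text \<open>The binomial coefficients \<open>q choose i\<close> with \<open>0 < i < q\<close> vanish
  in \<open>'f\<close>, and \<open>h\<close> maps integers to integers, so they vanish in
  \<open>'k\<close> too. The argument avoids knowing that \<open>q\<close> is a power of the
  characteristic.\<close>

lemma finite_field_hom_power_add:
  fixes h :: "'f::{field,finite} \<Rightarrow> 'k::field" and x y :: 'k
  assumes h1: "h 1 = 1" and hadd: "\<And>a b. h (a + b) = h a + h b"
  shows "(x + y) ^ CARD('f) = x ^ CARD('f) + y ^ CARD('f)"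
proof -
  define q where "q = CARD('f)"
  have q: "q > 1" using card_UNIV_field_gt_1[where ?'f = 'f] by (simp add: q_def)
  have split: "(\<Sum>i\<le>q. f i) = f 0 + f q + (\<Sum>i=1..<q. f i)" for f :: "nat \<Rightarrow> 'b::comm_monoid_add"
  proof -
    have "{..q} = insert 0 (insert q {1..<q})" using q by auto
    then show ?thesis using q by (simp add: add.assoc)
  qed
  \<comment> \<open>Multiplication by \<open>c\<close> permutes the nonzero elements, so their
    product can be cancelled. The extra factor \<open>c\<close> turns the exponent
    \<open>q - 1\<close> into \<open>q\<close>.\<close>
  have pw: "c ^ q = c" for c :: 'f
  proof (cases "c = 0")
    case False
    have "c * (\<Prod>y\<in>UNIV-{0}. c * y) = c * c ^ (q - 1) * \<Prod>(UNIV-{0})"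
      by (simp add: prod.distrib mult_ac q_def)
    also have "c * c ^ (q - 1) = c ^ q"
      using q by (simp flip: power_Suc)
    also have "(\<Prod>y\<in>UNIV-{0}. c * y) = (\<Prod>y\<in>UNIV-{0}. y)"
      by (rule prod.reindex_bij_witness[of _ "\<lambda>y. y / c" "\<lambda>y. c * y"]) (use False in auto)
    finally show ?thesis by simp
  qed (use q in auto)
  \<comment> \<open>The polynomial \<open>(X + 1)\<^sup>q - X\<^sup>q - 1\<close> has degree below \<open>q\<close> and vanishes on all of \<open>F\<^sub>q\<close>.\<close>
  define p :: "'f poly" where "p = (\<Sum>i=1..<q. Polynomial.monom (of_nat (q choose i)) i)"
  have "poly p c = 0" for c
  proof -
    have "(c + 1) ^ q = (\<Sum>i\<le>q. of_nat (q choose i) * c ^ i)"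
      by (simp add: binomial_ring)
    then have "(c + 1) ^ q = 1 + c ^ q + (\<Sum>i=1..<q. of_nat (q choose i) * c ^ i)"
      by (simp add: split)
    then show ?thesis
      by (simp add: p_def poly_sum poly_monom pw)
  qed
  moreover have "Polynomial.degree p \<le> q - 1"
    unfolding p_def by (rule degree_sum_le) (auto intro: order.trans[OF degree_monom_le])
  ultimately have "p = 0"
    using card_poly_roots_bound[of p] q by (force simp: q_def)
  have choose0: "of_nat (q choose i) = (0::'f)" if "i \<in> {1..<q}" for i
  proof -
    have "Polynomial.coeff p i = (\<Sum>j=1..<q. if j = i then of_nat (q choose j) else 0)"
      by (simp add: p_def coeff_sum)
    with \<open>p = 0\<close> that show ?thesis by simp
  qed
  have h0: "h 0 = 0" by (metis add_0 add_cancel_right_right hadd)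
  have hn: "h (of_nat n) = of_nat n" for n
    by (induction n) (simp_all add: h0 h1 hadd)
  have "of_nat (q choose i) = (0::'k)" if "i \<in> {1..<q}" for i
    using choose0[OF that] hn[of "q choose i"] h0 by simp
  then have "(\<Sum>i=1..<q. of_nat (q choose i) * x ^ i * y ^ (q - i)) = 0"
    by (intro sum.neutral) simp
  then have "(x + y) ^ q = x ^ q + y ^ q"
    by (simp only: binomial_ring split) simp
  then show ?thesis by (simp add: q_def)
qed

text \<open>Were the field finite, adding 1 to the product of all \<open>X - x\<close> would give a
  nonconstant polynomial without a root. Infinitude is what makes a twisted polynomial determined by
  its values.\<close>

lemma infinite_UNIV_alg_closed_field: "infinite (UNIV :: 'k::alg_closed_field set)"
proof
  assume fin: "finite (UNIV :: 'k set)"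
  define p :: "'k poly" where "p = (\<Prod>x\<in>UNIV. [:- x, 1:])"
  have "Polynomial.degree p = CARD('k)"
    unfolding p_def by (subst degree_prod_eq_sum_degree) auto
  then have "Polynomial.degree (1 + p) > 0"
    using fin by (subst degree_add_eq_right) (auto simp: card_gt_0_iff)
  then obtain x where "poly (1 + p) x = 0"
    using alg_closed_imp_poly_has_root by blast
  moreover have "poly p x = 0"
    using fin by (auto simp: p_def poly_prod prod_zero_iff)
  ultimately show False by simp
qed

lemma (in vector_space) card_span_le:
  assumes "finite S" "finite (UNIV :: 'a set)"
  shows "card (span S) \<le> CARD('a) ^ dim S"
proof -
  obtain B where B: "B \<subseteq> S" "independent B" "S \<subseteq> span B" "card B = dim S"
    using basis_exists[of S] by blast
  have finB: "finite B" using B(1) assms(1) finite_subset by blast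
  let ?F = "\<lambda>c. \<Sum>v\<in>B. scale (c v) v"
  have "span S \<subseteq> span B"
    using B(3) span_minimal subspace_span by blast
  also have "\<dots> \<subseteq> ?F ` (B \<rightarrow>\<^sub>E UNIV)"
  proof
    fix x assume "x \<in> span B"
    then obtain c where "x = ?F c" using span_finite[OF finB] by auto
    then have "x = ?F (restrict c B)" by simp
    then show "x \<in> ?F ` (B \<rightarrow>\<^sub>E UNIV)"
      by (intro image_eqI[where x = "restrict c B"]) simp_all
  qed
  finally have sub: "span S \<subseteq> ?F ` (B \<rightarrow>\<^sub>E UNIV)" .
  have fin: "finite (B \<rightarrow>\<^sub>E (UNIV :: 'a set))"
    using finB assms(2) by (simp add: finite_PiE)
  have "card (span S) \<le> card (B \<rightarrow>\<^sub>E (UNIV :: 'a set))"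
    using sub fin by (meson card_image_le card_mono finite_imageI order_trans)
  then show "card (span S) \<le> CARD('a) ^ dim S"
    using finB B(4) by (simp add: card_funcsetE)
qed

text \<open>A finite witness \<open>W\<close>, the set of combinations of a basis, serves the later
  pigeonhole argument without a finiteness proof for \<open>V\<close>.\<close>

lemma (in vector_space) card_subspace_ge:
  assumes "subspace V" "n < dim V" and fin: "finite (UNIV :: 'a set)"
  obtains W where "W \<subseteq> V" "finite W" "CARD('a) ^ n < card W"
proof -
  obtain B where B: "B \<subseteq> V" "independent B" "V \<subseteq> span B" "card B = dim V"
    using basis_exists[of V] by blast
  \<comment> \<open>An infinite basis would have \<open>card B = 0\<close>, which
    \<open>n < dim V\<close> excludes.\<close>
  have finB: "finite B" using B(4) assms(2) card.infinite by fastforce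
  let ?F = "\<lambda>c. \<Sum>v\<in>B. scale (c v) v"
  have inj: "inj_on ?F (B \<rightarrow>\<^sub>E UNIV)"
  proof (rule inj_onI)
    fix c c' assume c: "c \<in> B \<rightarrow>\<^sub>E UNIV" "c' \<in> B \<rightarrow>\<^sub>E UNIV" and eq: "?F c = ?F c'"
    have "(\<Sum>v\<in>B. scale (c v - c' v) v) = 0"
      using eq by (simp add: scale_left_diff_distrib sum_subtractf)
    then have "c v - c' v = 0" if "v \<in> B" for v
      using independentD[OF B(2) finB order_refl, of "\<lambda>v. c v - c' v"] that by blast
    then show "c = c'" using c by (intro PiE_ext) auto
  qed
  show thesis
  proof
    show "?F ` (B \<rightarrow>\<^sub>E UNIV) \<subseteq> V"
      using assms(1) B(1) by (auto intro!: subspace_sum subspace_scale)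
    show "finite (?F ` (B \<rightarrow>\<^sub>E UNIV))"
      using fin finB by (simp add: finite_PiE)
    show "CARD('a) ^ n < card (?F ` (B \<rightarrow>\<^sub>E UNIV))"
      using card_UNIV_field_gt_1[OF fin] finB B(4) assms(2)
      by (simp add: card_image[OF inj] card_funcsetE power_strict_increasing)
  qed
qed

section \<open>Counting with matrices of given rank over a finite field\<close>

lemma card_vec_constrained:
  fixes S :: "'a set"
  assumes "finite S"
  shows "card {x. \<forall>i. (x :: 'a ^ 'n) $ i \<in> S} \<le> card S ^ CARD('n)"
proof -
  have sub: "{x. \<forall>i. (x :: 'a ^ 'n) $ i \<in> S} \<subseteq> vec_lambda ` (UNIV \<rightarrow>\<^sub>E S)"
  proof
    fix x :: "'a ^ 'n" assume "x \<in> {x. \<forall>i. x $ i \<in> S}"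
    then have "vec_nth x \<in> UNIV \<rightarrow>\<^sub>E S" by auto
    then show "x \<in> vec_lambda ` (UNIV \<rightarrow>\<^sub>E S)" by (metis image_eqI vec_nth_inverse)
  qed
  have fin: "finite ((UNIV :: 'n set) \<rightarrow>\<^sub>E S)"
    using assms by (simp add: finite_PiE)
  have "card {x. \<forall>i. (x :: 'a ^ 'n) $ i \<in> S} \<le> card ((UNIV :: 'n set) \<rightarrow>\<^sub>E S)"
    using sub fin by (meson card_image_le card_mono finite_imageI order_trans)
  then show "card {x. \<forall>i. (x :: 'a ^ 'n) $ i \<in> S} \<le> card S ^ CARD('n)"
    by (simp add: card_funcsetE)
qed

text \<open>Every row of \<open>M ** A\<close> lies in the row space of \<open>A\<close>, and there
  are \<open>CARD('p)\<close> rows to choose.\<close>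

lemma card_matrix_multiples_le:
  fixes A :: "'e::{field,finite} ^ 'n ^ 'm"
  shows "card (range (\<lambda>M. (M :: 'e ^ 'm ^ 'p) ** A)) \<le> CARD('e) ^ (CARD('p) * rank A)"
proof -
  let ?S = "vec.span (rows A)"
  have finr: "finite (rows A)" by (simp add: rows_def)
  have "range (\<lambda>M. (M :: 'e ^ 'm ^ 'p) ** A) \<subseteq> {Z. \<forall>i. (Z :: 'e ^ 'n ^ 'p) $ i \<in> ?S}"
  proof clarify
    fix M :: "'e ^ 'm ^ 'p" and i
    have "(M ** A) $ i = (\<Sum>k\<in>UNIV. M $ i $ k *s row k A)"
      by (simp add: vec_eq_iff matrix_matrix_mult_def row_def)
    also have "\<dots> \<in> ?S"
      by (intro vec.span_sum vec.span_scale vec.span_base) (auto simp: rows_def)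
    finally show "(M ** A) $ i \<in> ?S" .
  qed
  then have "card (range (\<lambda>M. (M :: 'e ^ 'm ^ 'p) ** A)) \<le> card {Z. \<forall>i. (Z :: 'e ^ 'n ^ 'p) $ i \<in> ?S}"
    by (intro card_mono) auto
  also have "\<dots> \<le> card ?S ^ CARD('p)"
    by (rule card_vec_constrained) simp
  also have "\<dots> \<le> (CARD('e) ^ rank A) ^ CARD('p)"
    unfolding row_rank_def_gen
    by (intro power_mono vec.card_span_le finr) auto
  finally show ?thesis by (simp add: power_mult mult.commute)
qed

text \<open>Half of rank-nullity in counting form, written as a product so that no exponent is a
  difference. Pairing a vector with a basis of the row space takes at most
  \<open>CARD('e) ^ rank A\<close> values, and each fibre embeds into the kernel by
  translation.\<close>

lemma card_matrix_kernel_ge: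
  fixes A :: "'e::{field,finite} ^ 'n ^ 'm"
  shows "CARD('e) ^ CARD('n) \<le> card {c. A *v c = 0} * CARD('e) ^ rank A"
proof -
  obtain B where B: "B \<subseteq> rows A" "vec.independent B" "rows A \<subseteq> vec.span B" "card B = vec.dim (rows A)"
    using vec.basis_exists[of "rows A"] by blast
  have "finite (rows A)" by (simp add: rows_def)
  then have finB: "finite B" using B(1) finite_subset by blast
  define g :: "'e ^ 'n \<Rightarrow> 'e ^ 'n \<Rightarrow> 'e" where "g c = (\<lambda>x\<in>B. \<Sum>j\<in>UNIV. x $ j * c $ j)" for c
  have kernel: "A *v (c - c') = 0" if "g c = g c'" for c c'
  proof -
    \<comment> \<open>The vectors orthogonal to \<open>c - c'\<close> form a subspace; it contains
      \<open>B\<close>, hence every row of \<open>A\<close>.\<close>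
    let ?U = "{x. (\<Sum>j\<in>UNIV. (x :: 'e ^ 'n) $ j * (c - c') $ j) = 0}"
    have "vec.subspace ?U"
      by (rule vec.subspaceI)
         (simp_all add: distrib_right sum.distrib mult.assoc flip: sum_distrib_left)
    moreover have "B \<subseteq> ?U"
    proof
      fix x assume "x \<in> B"
      then show "x \<in> ?U"
        using fun_cong[OF that, of x] by (simp add: g_def right_diff_distrib sum_subtractf)
    qed
    ultimately have "vec.span B \<subseteq> ?U" by (rule vec.span_minimal[rotated])
    with B(3) have "row i A \<in> ?U" for i by (auto simp: rows_def)
    then show ?thesis by (simp add: vec_eq_iff matrix_vector_mult_def row_def)
  qed
  have fibre: "card {c. g c = y} \<le> card {c. A *v c = 0}" for y
  proof (cases "\<exists>c0. g c0 = y")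
    case True
    then obtain c0 where "g c0 = y" by blast
    then show ?thesis
      by (intro card_inj_on_le[of "\<lambda>c. c - c0"]) (auto intro!: kernel inj_onI)
  qed simp
  have img: "range g \<subseteq> B \<rightarrow>\<^sub>E UNIV" by (auto simp: g_def)
  have fin: "finite (B \<rightarrow>\<^sub>E (UNIV :: 'e set))" using finB by (simp add: finite_PiE)
  have "CARD('e) ^ CARD('n) = card (\<Union>y\<in>B \<rightarrow>\<^sub>E UNIV. {c. g c = y})"
  proof -
    have "(\<Union>y\<in>B \<rightarrow>\<^sub>E UNIV. {c. g c = y}) = UNIV" using img by blast
    then show ?thesis by simp
  qed
  also have "\<dots> \<le> (\<Sum>y\<in>B \<rightarrow>\<^sub>E (UNIV :: 'e set). card {c. g c = y})"
    by (rule card_UN_le[OF fin])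
  also have "\<dots> \<le> card (B \<rightarrow>\<^sub>E (UNIV :: 'e set)) * card {c. A *v c = 0}"
    using sum_bounded_above[of "B \<rightarrow>\<^sub>E (UNIV :: 'e set)", OF fibre] by simp
  also have "\<dots> = card {c. A *v c = 0} * CARD('e) ^ rank A"
    using finB B(4) by (simp add: card_funcsetE row_rank_def_gen)
  finally show ?thesis .
qed

section \<open>Twisted polynomials as additive functions\<close>

text \<open>Additivity of the \<open>q\<close>-th power is what makes twisted polynomials act by
  additive maps and \<open>skew_mult\<close> act as composition. The parameter \<open>K\<close>
  fixes the type \<open>'k\<close>, which \<open>q\<close> does not mention.\<close>

locale frobenius_power =
  fixes q :: nat and K :: "'k::field itself"
  assumes power_add: "(x + y) ^ q = x ^ q + (y :: 'k) ^ q"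
    and q_gt_1: "q > 1"
begin

lemma power_iterate_add: "(x + y) ^ (q ^ i) = x ^ (q ^ i) + (y :: 'k) ^ (q ^ i)"
  by (induction i) (simp_all add: power_add power_mult mult.commute[of q])

lemma power_iterate_sum: "(\<Sum>a\<in>S. f a) ^ (q ^ i) = (\<Sum>a\<in>S. (f a :: 'k) ^ (q ^ i))"
  using q_gt_1 by (induction S rule: infinite_finite_induct) (simp_all add: power_iterate_add)

lemma skew_eval_altdef:
  assumes "Polynomial.degree f \<le> n"
  shows "skew_eval q f x = (\<Sum>i\<le>n. Polynomial.coeff f i * (x :: 'k) ^ (q ^ i))"
  unfolding skew_eval_def using assms
  by (intro sum.mono_neutral_left) (auto simp: coeff_eq_0)

lemma skew_eval_0_left [simp]: "skew_eval q 0 (x :: 'k) = 0"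
  by (simp add: skew_eval_def)

lemma skew_eval_0_right [simp]: "skew_eval q f (0 :: 'k) = 0"
  using q_gt_1 by (simp add: skew_eval_def power_0_left)

lemma skew_eval_const [simp]: "skew_eval q [:c:] (x :: 'k) = c * x"
  by (simp add: skew_eval_def)

lemma skew_eval_monom: "skew_eval q (Polynomial.monom c n) (x :: 'k) = c * x ^ (q ^ n)"
proof -
  have "skew_eval q (Polynomial.monom c n) x = (\<Sum>i\<le>n. if i = n then c * x ^ (q ^ n) else 0)"
    unfolding skew_eval_altdef[OF degree_monom_le] by (intro sum.cong) auto
  then show ?thesis by simp
qed

lemma skew_eval_add_left: "skew_eval q (f + g) (x :: 'k) = skew_eval q f x + skew_eval q g x"
proof -
  let ?n = "max (Polynomial.degree f) (Polynomial.degree g)"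
  show ?thesis
    using skew_eval_altdef[of f ?n x] skew_eval_altdef[of g ?n x]
      skew_eval_altdef[OF degree_add_le_max, of f g x]
    by (simp add: distrib_right sum.distrib)
qed

lemma skew_eval_smult: "skew_eval q (smult c f) (x :: 'k) = c * skew_eval q f x"
  using skew_eval_altdef[OF degree_smult_le, of c f x]
  by (simp add: skew_eval_def sum_distrib_left mult.assoc)

lemma skew_eval_diff_left: "skew_eval q (f - g) (x :: 'k) = skew_eval q f x - skew_eval q g x"
  using skew_eval_add_left[of "f - g" g x] by simp

lemma skew_eval_sum_left: "skew_eval q (\<Sum>a\<in>S. f a) (x :: 'k) = (\<Sum>a\<in>S. skew_eval q (f a) x)"
  by (induction S rule: infinite_finite_induct) (simp_all add: skew_eval_add_left)

lemma skew_eval_add_right: "skew_eval q f (x + y :: 'k) = skew_eval q f x + skew_eval q f y"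
  by (simp add: skew_eval_def power_iterate_add distrib_left sum.distrib)

lemma skew_eval_diff_right: "skew_eval q f (x - y :: 'k) = skew_eval q f x - skew_eval q f y"
  using skew_eval_add_right[of f "x - y" y] by simp

lemma skew_eval_sum_right: "skew_eval q f (\<Sum>a\<in>S. x a :: 'k) = (\<Sum>a\<in>S. skew_eval q f (x a))"
  by (induction S rule: infinite_finite_induct) (simp_all add: skew_eval_add_right)

lemma skew_eval_skew_mult: "skew_eval q (skew_mult q f g) (x :: 'k) = skew_eval q f (skew_eval q g x)"
proof -
  have "skew_eval q (skew_mult q f g) x =
      (\<Sum>i\<le>Polynomial.degree f. \<Sum>j\<le>Polynomial.degree g.
        (Polynomial.coeff f i * Polynomial.coeff g j ^ q ^ i) * x ^ q ^ (i + j))"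
    by (simp add: skew_mult_def skew_eval_sum_left skew_eval_monom)
  also have "\<dots> = (\<Sum>i\<le>Polynomial.degree f. Polynomial.coeff f i *
      (\<Sum>j\<le>Polynomial.degree g. (Polynomial.coeff g j * x ^ q ^ j) ^ q ^ i))"
    by (simp add: sum_distrib_left power_mult_distrib Power.power_add mult.assoc
        flip: power_mult) (simp add: mult.commute)
  also have "\<dots> = skew_eval q f (skew_eval q g x)"
    by (simp add: skew_eval_def power_iterate_sum)
  finally show ?thesis .
qed

text \<open>The action of \<open>f\<close> is evaluation of an ordinary polynomial \<open>F\<close>
  in which the coefficients of \<open>f\<close> sit at the exponents \<open>q ^ i\<close>. These are
  distinct, so \<open>F\<close> is nonzero, and its degree is at most
  \<open>q ^ degree f\<close>.\<close>

lemma skew_eval_roots: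
  fixes f :: "'k skew_poly"
  assumes "f \<noteq> 0"
  shows "finite {x. skew_eval q f x = 0}" "card {x. skew_eval q f x = 0} \<le> q ^ Polynomial.degree f"
proof -
  let ?n = "Polynomial.degree f"
  define F where "F = (\<Sum>i\<le>?n. Polynomial.monom (Polynomial.coeff f i) (q ^ i))"
  have poly_F: "poly F x = skew_eval q f x" for x
    by (simp add: F_def poly_sum poly_monom skew_eval_def)
  have "Polynomial.coeff F (q ^ ?n) = (\<Sum>i\<le>?n. if i = ?n then Polynomial.coeff f i else 0)"
    using q_gt_1 by (simp add: F_def coeff_sum power_inject_exp)
  then have "F \<noteq> 0" using assms by auto
  moreover have "Polynomial.degree F \<le> q ^ ?n"
    unfolding F_def using q_gt_1
    by (intro degree_sum_le) (auto intro!: order.trans[OF degree_monom_le] power_increasing)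
  ultimately show "finite {x. skew_eval q f x = 0}" "card {x. skew_eval q f x = 0} \<le> q ^ ?n"
    using poly_roots_finite[of F] card_poly_roots_bound[of F] by (simp_all add: poly_F)
qed

lemma skew_eval_faithful:
  fixes f g :: "'k skew_poly"
  assumes "infinite (UNIV :: 'k set)" "\<And>x. skew_eval q f x = skew_eval q g x"
  shows "f = g"
  using skew_eval_roots(1)[of "f - g"] assms by (auto simp: skew_eval_diff_left)

lemma degree_skew_mult_le:
  "Polynomial.degree (skew_mult q f (g :: 'k skew_poly)) \<le> Polynomial.degree f + Polynomial.degree g"
  unfolding skew_mult_def
  by (intro degree_sum_le finite_atMost) (auto intro!: order.trans[OF degree_monom_le] add_mono)

text \<open>The top coefficient of the product is the leading coefficient of \<open>f\<close> times
  a Frobenius power of that of \<open>g\<close>: with \<open>i \<le> ?m\<close> and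
  \<open>j \<le> ?n\<close>, only \<open>i = ?m\<close> and \<open>j = ?n\<close> reach total degree
  \<open>?m + ?n\<close>.\<close>

lemma skew_mult_eq_0:
  fixes f g :: "'k skew_poly"
  assumes "skew_mult q f g = 0"
  shows "f = 0 \<or> g = 0"
proof (rule ccontr)
  assume nz: "\<not> (f = 0 \<or> g = 0)"
  let ?m = "Polynomial.degree f" and ?n = "Polynomial.degree g"
  have "Polynomial.coeff (skew_mult q f g) (?m + ?n) =
      (\<Sum>i\<le>?m. \<Sum>j\<le>?n. if i + j = ?m + ?n then Polynomial.coeff f i * Polynomial.coeff g j ^ q ^ i else 0)"
    by (simp add: skew_mult_def coeff_sum)
  also have "\<dots> = (\<Sum>i\<le>?m. \<Sum>j\<le>?n.
      if i = ?m then if j = ?n then lead_coeff f * lead_coeff g ^ q ^ ?m else 0 else 0)"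
    by (intro sum.cong refl) auto
  also have "\<dots> = (\<Sum>i\<le>?m. if i = ?m then lead_coeff f * lead_coeff g ^ q ^ ?m else 0)"
    by (intro sum.cong refl) simp
  also have "\<dots> = lead_coeff f * lead_coeff g ^ q ^ ?m"
    by simp
  finally show False using assms nz by simp
qed

text \<open>Distributivity over \<open>g - h\<close> is read off from values, after which the
  absence of zero divisors applies.\<close>

lemma skew_mult_left_cancel:
  fixes f g h :: "'k skew_poly"
  assumes "infinite (UNIV :: 'k set)" "f \<noteq> 0" "skew_mult q f g = skew_mult q f h"
  shows "g = h"
proof -
  have "skew_mult q f (g - h) = 0"
  proof (rule skew_eval_faithful[OF assms(1)])
    fix x
    have "skew_eval q (skew_mult q f (g - h)) x =
        skew_eval q (skew_mult q f g) x - skew_eval q (skew_mult q f h) x"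
      by (simp add: skew_eval_skew_mult skew_eval_diff_left skew_eval_diff_right)
    then show "skew_eval q (skew_mult q f (g - h)) x = skew_eval q 0 x"
      by (simp add: assms(3))
  qed
  then show ?thesis using skew_mult_eq_0 assms(2) by force
qed

end

section \<open>Endomorphisms and torsion of a Drinfeld module\<close>

locale drinfeld =
  fixes \<gamma> :: "'f::{field,finite} poly \<Rightarrow> 'k::alg_closed_field"
    and \<phi> :: "'f poly \<Rightarrow> 'k skew_poly"
    and r :: nat
  assumes gamma_1: "\<gamma> 1 = 1"
    and gamma_add: "\<gamma> (a + b) = \<gamma> a + \<gamma> b"
    and gamma_mult: "\<gamma> (a * b) = \<gamma> a * \<gamma> b"
    and module: "drinfeld_module \<gamma> r \<phi>"

text \<open>The constants of \<open>A\<close> give, through \<open>\<gamma>\<close>, the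
  homomorphism from \<open>'f\<close> into \<open>'k\<close> that makes the \<open>q\<close>-th
  power additive.\<close>

sublocale drinfeld \<subseteq> frobenius_power "CARD('f)" "TYPE('k)"
proof
  show "(x + y) ^ CARD('f) = x ^ CARD('f) + y ^ CARD('f)" for x y :: 'k
    by (rule finite_field_hom_power_add[of "\<lambda>c. \<gamma> [:c:]"])
       (simp_all add: gamma_1 flip: gamma_add one_pCons)
  show "CARD('f) > 1" by (rule card_UNIV_field_gt_1) simp
qed

context drinfeld
begin

abbreviation act :: "'f poly \<Rightarrow> 'k \<Rightarrow> 'k" where
  "act a \<equiv> skew_eval CARD('f) (\<phi> a)"

lemma act_add: "act (a + b) x = act a x + act b x"
  using module by (simp add: drinfeld_module_def skew_eval_add_left)

lemma act_mult: "act (a * b) x = act a (act b x)"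
  using module by (simp add: drinfeld_module_def skew_eval_skew_mult)

lemma act_const: "act [:c:] x = \<gamma> [:c:] * x"
  using module by (simp add: drinfeld_module_def)

lemma act_1: "act 1 x = x"
  using act_const[of 1 x] by (simp add: gamma_1 flip: one_pCons)

lemma act_commute: "act a (act b x) = act b (act a x)"
  by (simp add: mult.commute flip: act_mult)

lemma skew_poly_eqI:
  fixes f g :: "'k skew_poly"
  assumes "\<And>x. skew_eval CARD('f) f x = skew_eval CARD('f) g x"
  shows "f = g"
  using skew_eval_faithful infinite_UNIV_alg_closed_field assms by blast

text \<open>Commutation of twisted polynomials is tested on values because evaluation is faithful.
  Closure properties of the endomorphism ring thus become pointwise computations.\<close>

lemma drinfeld_End_iff:
  "u \<in> drinfeld_End \<phi> \<longleftrightarrow> (\<forall>a x. skew_eval CARD('f) u (act a x) = act a (skew_eval CARD('f) u x))"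
proof
  assume "u \<in> drinfeld_End \<phi>"
  then have eq: "skew_mult CARD('f) u (\<phi> a) = skew_mult CARD('f) (\<phi> a) u" for a
    by (simp add: drinfeld_End_def)
  show "\<forall>a x. skew_eval CARD('f) u (act a x) = act a (skew_eval CARD('f) u x)"
    using eq by (simp flip: skew_eval_skew_mult)
next
  assume "\<forall>a x. skew_eval CARD('f) u (act a x) = act a (skew_eval CARD('f) u x)"
  then show "u \<in> drinfeld_End \<phi>"
    by (auto simp: drinfeld_End_def skew_eval_skew_mult intro: skew_poly_eqI)
qed

lemma drinfeld_End_diff:
  "u \<in> drinfeld_End \<phi> \<Longrightarrow> v \<in> drinfeld_End \<phi> \<Longrightarrow> u - v \<in> drinfeld_End \<phi>"
  by (simp add: drinfeld_End_iff skew_eval_diff_left skew_eval_diff_right)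

lemma drinfeld_End_skew_mult:
  "u \<in> drinfeld_End \<phi> \<Longrightarrow> v \<in> drinfeld_End \<phi> \<Longrightarrow> skew_mult CARD('f) u v \<in> drinfeld_End \<phi>"
  by (simp add: drinfeld_End_iff skew_eval_skew_mult)

lemma bounded_End_altdef: "bounded_End \<phi> n = {u \<in> drinfeld_End \<phi>. Polynomial.degree u \<le> n}"
proof -
  have "0 \<in> drinfeld_End \<phi>" by (simp add: drinfeld_End_iff)
  then show ?thesis by (auto simp: bounded_End_def)
qed

lemma bounded_End_diff:
  "u \<in> bounded_End \<phi> n \<Longrightarrow> v \<in> bounded_End \<phi> n \<Longrightarrow> u - v \<in> bounded_End \<phi> n"
  by (auto simp: bounded_End_altdef drinfeld_End_diff intro: degree_diff_le)

lemma bounded_End_skew_mult: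
  assumes "u \<in> bounded_End \<phi> m" "v \<in> bounded_End \<phi> n"
  shows "skew_mult CARD('f) u v \<in> bounded_End \<phi> (m + n)"
  using assms degree_skew_mult_le[of u v] by (auto simp: bounded_End_altdef drinfeld_End_skew_mult)

sublocale Fq: vector_space "Fq_scale \<gamma>"
proof
  fix a b :: 'f and x y :: "'k skew_poly"
  have "[:a + b:] = [:a:] + [:b:]" "[:a * b:] = [:a:] * [:b:]" by simp_all
  then show "Fq_scale \<gamma> (a + b) x = Fq_scale \<gamma> a x + Fq_scale \<gamma> b x"
    and "Fq_scale \<gamma> a (Fq_scale \<gamma> b x) = Fq_scale \<gamma> (a * b) x"
    by (simp_all only: Fq_scale_def gamma_add gamma_mult smult_add_left smult_smult)
  show "Fq_scale \<gamma> 1 x = x" by (simp add: Fq_scale_def gamma_1 flip: one_pCons)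
  show "Fq_scale \<gamma> a (x + y) = Fq_scale \<gamma> a x + Fq_scale \<gamma> a y"
    by (simp add: Fq_scale_def smult_add_right)
qed

lemma subspace_bounded_End: "Fq.subspace (bounded_End \<phi> n)"
proof (rule Fq.subspaceI)
  show zero: "0 \<in> bounded_End \<phi> n" by (simp add: bounded_End_def)
  show "x + y \<in> bounded_End \<phi> n" if "x \<in> bounded_End \<phi> n" "y \<in> bounded_End \<phi> n" for x y
    using bounded_End_diff[OF that(1) bounded_End_diff[OF zero that(2)]] by simp
  \<comment> \<open>Scaling by \<open>c\<close> acts as \<open>act [:c:]\<close>, which commutes
    with every \<open>act a\<close> since \<open>A\<close> is commutative.\<close>
  show "Fq_scale \<gamma> c x \<in> bounded_End \<phi> n" if "x \<in> bounded_End \<phi> n" for c x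
    using that by (auto simp: bounded_End_altdef drinfeld_End_iff Fq_scale_def skew_eval_smult
        simp flip: act_const intro: act_commute order.trans[OF degree_smult_le])
qed

section \<open>Torsion submodules and their independence\<close>

lemma torsion_act: "x \<in> torsion \<phi> Q \<Longrightarrow> act a x \<in> torsion \<phi> Q"
  by (simp add: torsion_def act_commute[of Q])

lemma torsion_add: "x \<in> torsion \<phi> Q \<Longrightarrow> y \<in> torsion \<phi> Q \<Longrightarrow> x + y \<in> torsion \<phi> Q"
  by (simp add: torsion_def skew_eval_add_right)

lemma torsion_diff: "x \<in> torsion \<phi> Q \<Longrightarrow> y \<in> torsion \<phi> Q \<Longrightarrow> x - y \<in> torsion \<phi> Q"
  by (simp add: torsion_def skew_eval_diff_right)

lemma torsion_0: "0 \<in> torsion \<phi> Q"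
  by (simp add: torsion_def)

lemma torsion_sum: "(\<And>i. i \<in> S \<Longrightarrow> x i \<in> torsion \<phi> Q) \<Longrightarrow> (\<Sum>i\<in>S. x i) \<in> torsion \<phi> Q"
  by (induction S rule: infinite_finite_induct) (simp_all add: torsion_add torsion_0)

lemma torsion_End:
  "u \<in> drinfeld_End \<phi> \<Longrightarrow> x \<in> torsion \<phi> Q \<Longrightarrow> skew_eval CARD('f) u x \<in> torsion \<phi> Q"
  by (simp add: torsion_def drinfeld_End_iff) (metis skew_eval_0_right)

lemma torsion_dvd: "Q dvd a \<Longrightarrow> x \<in> torsion \<phi> Q \<Longrightarrow> act a x = 0"
  using torsion_act[of x Q] by (auto simp: torsion_def act_mult elim!: dvdE)

text \<open>The Chinese remainder theorem in the form that the sum of the torsion modules inside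
  \<open>'k\<close> is direct.\<close>

lemma torsion_sum_eq_0:
  assumes fin: "finite I"
    and \<pi>: "\<And>i. i \<in> I \<Longrightarrow> residue_map (\<qq> i) (\<pi> i :: 'f poly \<Rightarrow> 'e::field)"
    and ndvd: "\<And>i j. i \<in> I \<Longrightarrow> j \<in> I \<Longrightarrow> i \<noteq> j \<Longrightarrow> \<not> \<qq> i dvd \<qq> j"
    and x: "\<And>i. i \<in> I \<Longrightarrow> x i \<in> torsion \<phi> (\<qq> i)"
    and sum0: "(\<Sum>i\<in>I. x i) = 0" and i: "i \<in> I"
  shows "x i = 0"
proof -
  \<comment> \<open>An inverse \<open>a\<close> of \<open>R\<close> modulo \<open>\<qq> i\<close> makes \<open>aR\<close> the projection onto the \<open>i\<close>-th summand.\<close>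
  define R where "R = (\<Prod>j\<in>I - {i}. \<qq> j)"
  have hom: "\<pi> i 1 = 1" "\<pi> i (a * b) = \<pi> i a * \<pi> i b" "\<pi> i (a + b) = \<pi> i a + \<pi> i b" "surj (\<pi> i)"
    "\<pi> i a = 0 \<longleftrightarrow> \<qq> i dvd a" for a b
    using \<pi>[OF i] by (simp_all add: residue_map_def)
  have prod: "\<pi> i (\<Prod>j\<in>J. \<qq> j) = (\<Prod>j\<in>J. \<pi> i (\<qq> j))" for J
    by (induction J rule: infinite_finite_induct) (simp_all add: hom)
  \<comment> \<open>The residue ring is a field, so it suffices that no single factor of
    \<open>R\<close> is divisible by \<open>\<qq> i\<close>.\<close>
  have "\<pi> i R \<noteq> 0"
    using fin ndvd[OF i] by (auto simp: R_def prod hom(5))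
  obtain a where a: "\<pi> i a = inverse (\<pi> i R)" using hom(4) by (metis surjD)
  have "\<pi> i (a * R - 1) = 0"
    using hom(3)[of "a * R - 1" 1] \<open>\<pi> i R \<noteq> 0\<close> a by (simp add: hom(1,2))
  then have "\<qq> i dvd a * R - 1" using hom(5) by simp
  then have "act (a * R - 1) (x i) = 0" by (rule torsion_dvd) (rule x[OF i])
  then have aR: "x i = act (a * R) (x i)"
    using act_add[of "a * R - 1" 1 "x i"] by (simp add: act_1)
  have "act (a * R) (x j) = 0" if "j \<in> I - {i}" for j
    using that fin by (intro torsion_dvd[OF _ x]) (auto simp: R_def intro!: dvd_mult dvd_prodI)
  then have "act (a * R) (\<Sum>j\<in>I. x j) = act (a * R) (x i)"
    using fin i by (simp add: sum.remove[of I i] skew_eval_add_right skew_eval_sum_right)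
  then show ?thesis using aR sum0 by simp
qed

text \<open>Roots of \<open>w\<close> are closed under addition. Since the torsion sum is direct,
  tuples of torsion roots inject by summation into all roots of \<open>w\<close>, which are bounded
  by its degree.\<close>

lemma prod_card_torsion_roots_le:
  assumes fin: "finite I"
    and \<pi>: "\<And>i. i \<in> I \<Longrightarrow> residue_map (\<qq> i) (\<pi> i :: 'f poly \<Rightarrow> 'e::field)"
    and ndvd: "\<And>i j. i \<in> I \<Longrightarrow> j \<in> I \<Longrightarrow> i \<noteq> j \<Longrightarrow> \<not> \<qq> i dvd \<qq> j"
    and w: "w \<noteq> 0"
  shows "(\<Prod>i\<in>I. card {\<alpha> \<in> torsion \<phi> (\<qq> i). skew_eval CARD('f) w \<alpha> = 0}) \<le> CARD('f) ^ Polynomial.degree w"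
proof -
  let ?S = "\<lambda>i. {\<alpha> \<in> torsion \<phi> (\<qq> i). skew_eval CARD('f) w \<alpha> = 0}"
  have "inj_on (\<lambda>x. \<Sum>i\<in>I. x i) (Pi\<^sub>E I ?S)"
  proof (rule inj_onI)
    fix x y assume x: "x \<in> Pi\<^sub>E I ?S" and y: "y \<in> Pi\<^sub>E I ?S" and eq: "(\<Sum>i\<in>I. x i) = (\<Sum>i\<in>I. y i)"
    have "x i - y i = 0" if "i \<in> I" for i
      using fin \<pi> ndvd _ _ that
    proof (rule torsion_sum_eq_0)
      show "x i - y i \<in> torsion \<phi> (\<qq> i)" if "i \<in> I" for i
        using x y that by (auto intro!: torsion_diff dest: PiE_mem)
      show "(\<Sum>i\<in>I. x i - y i) = 0" using eq by (simp add: sum_subtractf)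
    qed
    then show "x = y" using x y by (intro PiE_ext) auto
  qed
  moreover have "(\<lambda>x. \<Sum>i\<in>I. x i) ` Pi\<^sub>E I ?S \<subseteq> {\<alpha>. skew_eval CARD('f) w \<alpha> = 0}"
  proof clarify
    fix x assume "x \<in> Pi\<^sub>E I ?S"
    then show "skew_eval CARD('f) w (\<Sum>i\<in>I. x i) = 0"
      unfolding skew_eval_sum_right by (intro sum.neutral) (auto dest: PiE_mem)
  qed
  ultimately have "card (Pi\<^sub>E I ?S) \<le> card {\<alpha>. skew_eval CARD('f) w \<alpha> = 0}"
    using skew_eval_roots(1)[OF w] by (intro card_inj_on_le)
  then show ?thesis
    using skew_eval_roots(2)[OF w] fin by (simp add: card_PiE)
qed

end

section \<open>Coordinates on one torsion module and the matrices of endomorphisms\<close>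

locale torsion_frame = drinfeld \<gamma> \<phi> r
  for \<gamma> :: "'f::{field,finite} poly \<Rightarrow> 'k::alg_closed_field"
    and \<phi> :: "'f poly \<Rightarrow> 'k skew_poly" and r +
  fixes Q :: "'f poly" and \<pi> :: "'f poly \<Rightarrow> 'e::field" and b :: "'n::finite \<Rightarrow> 'k"
  assumes residue: "residue_map Q \<pi>" and basis: "torsion_basis \<phi> Q \<pi> b"
begin

abbreviation "L \<equiv> tors_lincomb \<phi> \<pi> b"

text \<open>Two representatives of a residue differ by a multiple of \<open>Q\<close>, which kills
  the \<open>Q\<close>-torsion; so the choice made by \<open>SOME\<close> is harmless.\<close>

lemma tors_scale_eq:
  assumes "\<alpha> \<in> torsion \<phi> Q"
  shows "tors_scale \<phi> \<pi> (\<pi> a) \<alpha> = act a \<alpha>"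
proof -
  define a' where "a' = (SOME c. \<pi> c = \<pi> a)"
  have hom: "\<pi> (x + y) = \<pi> x + \<pi> y" "\<pi> x = 0 \<longleftrightarrow> Q dvd x" for x y
    using residue by (simp_all add: residue_map_def)
  have "\<pi> a' = \<pi> a" unfolding a'_def by (rule someI) simp
  then have "\<pi> (a' - a) = 0" using hom(1)[of "a' - a" a] by simp
  then have "act (a' - a) \<alpha> = 0" using hom(2) torsion_dvd assms by blast
  then show ?thesis
    using act_add[of "a' - a" a \<alpha>] by (simp add: tors_scale_def flip: a'_def)
qed

lemma residue_cases: obtains a where "x = \<pi> a"
  using residue by (metis residue_map_def surjD)

lemma tors_scale_in: "\<alpha> \<in> torsion \<phi> Q \<Longrightarrow> tors_scale \<phi> \<pi> x \<alpha> \<in> torsion \<phi> Q"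
  by (metis residue_cases tors_scale_eq torsion_act)

lemma tors_scale_add_left:
  assumes "\<alpha> \<in> torsion \<phi> Q"
  shows "tors_scale \<phi> \<pi> (x + y) \<alpha> = tors_scale \<phi> \<pi> x \<alpha> + tors_scale \<phi> \<pi> y \<alpha>"
proof -
  obtain a c where "x = \<pi> a" "y = \<pi> c" by (metis residue_cases)
  moreover have "\<pi> a + \<pi> c = \<pi> (a + c)" using residue by (simp add: residue_map_def)
  ultimately show ?thesis using assms by (simp add: tors_scale_eq act_add)
qed

lemma tors_scale_mult:
  assumes "\<alpha> \<in> torsion \<phi> Q"
  shows "tors_scale \<phi> \<pi> (x * y) \<alpha> = tors_scale \<phi> \<pi> x (tors_scale \<phi> \<pi> y \<alpha>)"
proof -
  obtain a c where "x = \<pi> a" "y = \<pi> c" by (metis residue_cases)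
  moreover have "\<pi> a * \<pi> c = \<pi> (a * c)" using residue by (simp add: residue_map_def)
  ultimately show ?thesis using assms by (simp add: tors_scale_eq act_mult torsion_act)
qed

lemma tors_scale_sum_right: "tors_scale \<phi> \<pi> x (\<Sum>i\<in>S. \<alpha> i) = (\<Sum>i\<in>S. tors_scale \<phi> \<pi> x (\<alpha> i))"
  by (simp add: tors_scale_def skew_eval_sum_right)

lemma End_tors_scale:
  "u \<in> drinfeld_End \<phi> \<Longrightarrow>
    skew_eval CARD('f) u (tors_scale \<phi> \<pi> x \<alpha>) = tors_scale \<phi> \<pi> x (skew_eval CARD('f) u \<alpha>)"
  by (simp add: tors_scale_def drinfeld_End_iff)

lemma b_in: "b j \<in> torsion \<phi> Q"
  using basis by (simp add: torsion_basis_def)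

lemma L_in: "L c \<in> torsion \<phi> Q"
  unfolding tors_lincomb_def by (intro torsion_sum tors_scale_in b_in)

lemma L_add: "L (c + c') = L c + L c'"
  by (simp add: tors_lincomb_def tors_scale_add_left b_in sum.distrib)

lemma L_diff: "L (c - c') = L c - L c'"
  using L_add[of "c - c'" c'] by simp

lemma L_inj: "L c = L c' \<longleftrightarrow> c = c'"
  using basis L_diff[of c c'] by (auto simp: torsion_basis_def)

lemma L_0: "L 0 = 0"
  using L_diff[of 0 0] by simp

lemma L_sum: "L (\<Sum>i\<in>S. c i) = (\<Sum>i\<in>S. L (c i))"
  by (induction S rule: infinite_finite_induct) (simp_all add: L_0 L_add)

lemma L_scale: "L (x *s c) = tors_scale \<phi> \<pi> x (L c)"
  by (simp add: tors_lincomb_def tors_scale_mult b_in tors_scale_sum_right)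

lemma L_tors_coords:
  assumes "\<alpha> \<in> torsion \<phi> Q"
  shows "L (tors_coords \<phi> \<pi> b \<alpha>) = \<alpha>"
proof -
  obtain c where "\<alpha> = L c" using assms basis by (auto simp: torsion_basis_def)
  then show ?thesis by (simp add: tors_coords_def L_inj)
qed

text \<open>The coordinate map \<open>L\<close> turns the action of \<open>u\<close> into
  multiplication by its matrix. As \<open>L\<close> is injective, sums and composites of
  endomorphisms can then be compared with those of matrices.\<close>

lemma End_L:
  assumes u: "u \<in> drinfeld_End \<phi>"
  shows "skew_eval CARD('f) u (L c) = L (tors_rep \<phi> \<pi> b u *v c)"
proof -
  let ?M = "tors_rep \<phi> \<pi> b u"
  have "column j ?M = tors_coords \<phi> \<pi> b (skew_eval CARD('f) u (b j))" for j
    by (simp add: column_def tors_rep_def vec_eq_iff)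
  then have col: "skew_eval CARD('f) u (b j) = L (column j ?M)" for j
    using L_tors_coords[OF torsion_End[OF u b_in]] by simp
  have "skew_eval CARD('f) u (L c) = (\<Sum>j\<in>UNIV. tors_scale \<phi> \<pi> (c $ j) (skew_eval CARD('f) u (b j)))"
    by (simp add: tors_lincomb_def skew_eval_sum_right End_tors_scale[OF u])
  also have "\<dots> = L (\<Sum>j\<in>UNIV. c $ j *s column j ?M)"
    by (simp add: col L_sum L_scale)
  finally show ?thesis by (simp add: matrix_mult_sum)
qed

lemma tors_rep_eqI:
  assumes "u \<in> drinfeld_End \<phi>" "\<And>c. skew_eval CARD('f) u (L c) = L (M *v c)"
  shows "tors_rep \<phi> \<pi> b u = M"
  using assms by (simp add: matrix_eq End_L L_inj)

lemma tors_rep_diff: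
  assumes "u \<in> drinfeld_End \<phi>" "v \<in> drinfeld_End \<phi>"
  shows "tors_rep \<phi> \<pi> b (u - v) = tors_rep \<phi> \<pi> b u - tors_rep \<phi> \<pi> b v"
  using assms
  by (intro tors_rep_eqI drinfeld_End_diff)
     (simp_all add: skew_eval_diff_left End_L L_diff matrix_vector_mult_diff_rdistrib)

lemma tors_rep_skew_mult:
  assumes "u \<in> drinfeld_End \<phi>" "v \<in> drinfeld_End \<phi>"
  shows "tors_rep \<phi> \<pi> b (skew_mult CARD('f) u v) = tors_rep \<phi> \<pi> b u ** tors_rep \<phi> \<pi> b v"
  using assms
  by (intro tors_rep_eqI drinfeld_End_skew_mult)
     (simp_all add: skew_eval_skew_mult End_L matrix_vector_mul_assoc)

text \<open>\<open>L\<close> carries the kernel of \<open>A\<close> injectively to torsion points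
  killed by \<open>w\<close>. Finiteness of the root set matters because an infinite set has
  cardinality 0.\<close>

lemma card_kernel_on_torsion_ge:
  assumes w: "w \<in> drinfeld_End \<phi>" and M: "tors_rep \<phi> \<pi> b w = M ** A"
    and fin: "finite {\<alpha>. skew_eval CARD('f) w \<alpha> = 0}"
  shows "card {c. A *v c = 0} \<le> card {\<alpha> \<in> torsion \<phi> Q. skew_eval CARD('f) w \<alpha> = 0}"
proof (rule card_inj_on_le)
  show "inj_on L {c. A *v c = 0}" by (simp add: inj_on_def L_inj)
  show "L ` {c. A *v c = 0} \<subseteq> {\<alpha> \<in> torsion \<phi> Q. skew_eval CARD('f) w \<alpha> = 0}"
    by (auto simp: L_in End_L[OF w] M L_0 simp flip: matrix_vector_mul_assoc)
  show "finite {\<alpha> \<in> torsion \<phi> Q. skew_eval CARD('f) w \<alpha> = 0}"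
    using fin by (rule finite_subset[rotated]) auto
qed

end

section \<open>Decoding\<close>

lemma monic_dvd_same_degree_imp_eq:
  fixes p p' :: "'a::field poly"
  assumes "p dvd p'" "lead_coeff p = 1" "lead_coeff p' = 1" "Polynomial.degree p = Polynomial.degree p'"
  shows "p = p'"
proof -
  obtain c where c: "p' = p * c" using assms(1) by (elim dvdE)
  have "p \<noteq> 0" "c \<noteq> 0" using assms(2,3) c by auto
  then have "Polynomial.degree c = 0" using assms(4) c by (simp add: degree_mult_eq)
  moreover have "lead_coeff c = 1" using assms(2,3) c by (simp add: lead_coeff_mult)
  ultimately have "c = 1" by (metis degree_0_id one_pCons)
  then show ?thesis using c by simp
qed

lemma matrix_diff_rdistrib:
  fixes A B :: "'a::ring_1 ^ 'n ^ 'm"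
  shows "(A - B) ** C = A ** C - B ** C"
  by (simp add: vec_eq_iff matrix_matrix_mult_def left_diff_distrib sum_subtractf)

theorem proposition4p1:
  fixes P :: "'f::{field,finite} poly"
    and red :: "'f poly \<Rightarrow> 'p::field"
    and \<gamma> :: "'f poly \<Rightarrow> 'p alg_closure"
    and \<phi> :: "'f poly \<Rightarrow> 'p alg_closure skew_poly"
    and \<qq> :: "nat \<Rightarrow> 'f poly"
    and \<pi> :: "nat \<Rightarrow> 'f poly \<Rightarrow> 'e::{field,finite}"
    and b :: "nat \<Rightarrow> 'n::finite \<Rightarrow> 'p alg_closure"
    and \<rho> :: "nat \<Rightarrow> 'p alg_closure skew_poly \<Rightarrow> 'e ^ 'n ^ 'n"
    and u :: "'p alg_closure skew_poly"
    and E Y :: "nat \<Rightarrow> 'e ^ 'n ^ 'n"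
    and d r m l t s \<epsilon> lam :: nat
  assumes P: "prime_elem P" "lead_coeff P = 1"
    and d: "d = Polynomial.degree P"
    and red: "residue_map P red"
    and \<gamma>: "\<gamma> = (\<lambda>a. to_ac (red a))"
    and r: "r = CARD('n)" "r \<ge> 2"
    and \<phi>: "drinfeld_module \<gamma> r \<phi>" "supersingular P r \<phi>"
    and \<qq>: "\<And>i. i \<in> {1..l} \<Longrightarrow>
              Factorial_Ring.irreducible (\<qq> i) \<and> lead_coeff (\<qq> i) = 1 \<and>
              Polynomial.degree (\<qq> i) = m \<and> \<qq> i \<noteq> P"
    and distinct: "inj_on \<qq> {1..l}"
    and t: "1 \<le> t" "t \<le> l * r"
    and s: "s = t * m - 1"
    and tm: "real (t * m) - 1 \<ge> real r ^ 2 * (real r - 1) * (real d - 1) / 2"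
    and card_e: "CARD('e) = CARD('f) ^ m"
    and \<pi>: "\<And>i. i \<in> {1..l} \<Longrightarrow> residue_map (\<qq> i) (\<pi> i)"
    and b: "\<And>i. i \<in> {1..l} \<Longrightarrow> torsion_basis \<phi> (\<qq> i) (\<pi> i) (b i)"
    and \<rho>: "\<And>i. i \<in> {1..l} \<Longrightarrow> \<rho> i = tors_rep \<phi> (\<pi> i) (b i)"
    and u: "u \<in> bounded_End \<phi> s"
    and Y: "\<And>i. i \<in> {1..l} \<Longrightarrow> Y i = \<rho> i u + E i"
    and dim: "Fq_dim \<gamma> (bounded_End \<phi> lam) > m * r * \<epsilon>"
    and bound: "int lam + int s < int m * (int l * int r - int \<epsilon>)"
    and errors: "(\<Sum>i=1..l. rank (E i)) \<le> \<epsilon>"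
  shows "(\<exists>v\<in>bounded_End \<phi> lam. \<exists>N\<in>bounded_End \<phi> (lam + s).
            (v, N) \<noteq> (0, 0) \<and> (\<forall>i\<in>{1..l}. \<rho> i v ** Y i = \<rho> i N)) \<and>
         (\<forall>v\<in>bounded_End \<phi> lam. \<forall>N\<in>bounded_End \<phi> (lam + s).
            (v, N) \<noteq> (0, 0) \<and> (\<forall>i\<in>{1..l}. \<rho> i v ** Y i = \<rho> i N) \<longrightarrow>
            N = skew_mult CARD('f) v u \<and> v \<noteq> 0 \<and> is_right_quotient CARD('f) N v u)"
proof -
  let ?q = "CARD('f)"
  interpret drinfeld \<gamma> \<phi> r
    using red \<phi>(1) by unfold_locales (simp_all add: \<gamma> residue_map_def)
  have frame: "torsion_frame \<gamma> \<phi> r (\<qq> i) (\<pi> i) (b i)" if "i \<in> {1..l}" for i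
    using \<pi>[OF that] b[OF that] by unfold_locales
  have rho_diff: "\<rho> i (v - w) = \<rho> i v - \<rho> i w"
    and rho_mult: "\<rho> i (skew_mult ?q v w) = \<rho> i v ** \<rho> i w"
    if "i \<in> {1..l}" "v \<in> drinfeld_End \<phi>" "w \<in> drinfeld_End \<phi>" for i v w
    using torsion_frame.tors_rep_diff[OF frame] torsion_frame.tors_rep_skew_mult[OF frame] that
    by (simp_all add: \<rho>)
  have End: "v \<in> drinfeld_End \<phi>" if "v \<in> bounded_End \<phi> n" for v n
    using that by (simp add: bounded_End_altdef)
  have ndvd: "\<not> \<qq> i dvd \<qq> j" if "i \<in> {1..l}" "j \<in> {1..l}" "i \<noteq> j" for i j
  proof
    assume "\<qq> i dvd \<qq> j"
    then have "\<qq> i = \<qq> j"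
      using \<qq>[OF that(1)] \<qq>[OF that(2)] by (intro monic_dvd_same_degree_imp_eq) metis+
    then show False using inj_onD[OF distinct _ that(1,2)] that(3) by simp
  qed

  have N_eq: "N = skew_mult ?q v u"
    if v: "v \<in> bounded_End \<phi> lam" and N: "N \<in> bounded_End \<phi> (lam + s)"
      and sol: "\<forall>i\<in>{1..l}. \<rho> i v ** Y i = \<rho> i N" for v N
  proof (rule ccontr)
    define w where "w = N - skew_mult ?q v u"
    assume "N \<noteq> skew_mult ?q v u"
    then have w0: "w \<noteq> 0" by (simp add: w_def)
    have w: "w \<in> bounded_End \<phi> (lam + s)"
      unfolding w_def using bounded_End_diff[OF N bounded_End_skew_mult[OF v u]] .
    have rho_w: "\<rho> i w = \<rho> i v ** E i" if i: "i \<in> {1..l}" for i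
    proof -
      have "\<rho> i w = \<rho> i N - \<rho> i v ** \<rho> i u"
        unfolding w_def using i End[OF v] End[OF N] End[OF u]
        by (simp add: rho_diff rho_mult drinfeld_End_skew_mult)
      also have "\<rho> i N = \<rho> i v ** \<rho> i u + \<rho> i v ** E i"
        using bspec[OF sol i] Y[OF i] by (simp add: matrix_add_ldistrib)
      finally show ?thesis by simp
    qed
    let ?K = "\<lambda>i. card {\<alpha> \<in> torsion \<phi> (\<qq> i). skew_eval ?q w \<alpha> = 0}"
    \<comment> \<open>Each residue field has \<open>?q ^ m\<close> elements, so this is the kernel
      count for \<open>E i\<close> rewritten in powers of \<open>?q\<close>, with the rank term kept
      on the right.\<close>
    have K: "?q ^ (m * r) \<le> ?K i * ?q ^ (m * rank (E i))" if i: "i \<in> {1..l}" for i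
    proof -
      have "card {c. E i *v c = 0} \<le> ?K i"
        using rho_w[OF i] unfolding \<rho>[OF i]
        by (rule torsion_frame.card_kernel_on_torsion_ge[OF frame[OF i] End[OF w] _ skew_eval_roots(1)[OF w0]])
      then have "CARD('e) ^ CARD('n) \<le> ?K i * CARD('e) ^ rank (E i)"
        using card_matrix_kernel_ge[of "E i"] by (meson mult_le_mono1 order_trans)
      then show ?thesis by (simp add: card_e r(1) power_mult)
    qed
    have "?q ^ (m * r * l) = (\<Prod>i=1..l. ?q ^ (m * r))"
      by (simp add: power_mult)
    also have "\<dots> \<le> (\<Prod>i=1..l. ?K i * ?q ^ (m * rank (E i)))"
      by (intro prod_mono) (use K in auto)
    also have "\<dots> = (\<Prod>i=1..l. ?K i) * ?q ^ (m * (\<Sum>i=1..l. rank (E i)))"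
      by (simp add: prod.distrib sum_distrib_left power_sum)
    also have "\<dots> \<le> ?q ^ Polynomial.degree w * ?q ^ (m * \<epsilon>)"
      using prod_card_torsion_roots_le[OF _ \<pi> ndvd w0, of "{1..l}" "\<lambda>i. i"] q_gt_1 errors
      by (intro mult_le_mono power_increasing) auto
    also have "\<dots> \<le> ?q ^ (lam + s + m * \<epsilon>)"
      using w q_gt_1 unfolding Power.power_add[symmetric]
      by (intro power_increasing) (auto simp: bounded_End_altdef)
    finally have "m * r * l \<le> lam + s + m * \<epsilon>"
      using q_gt_1 by (simp add: power_increasing_iff)
    \<comment> \<open>The comparison moves to integers because \<open>bound\<close> contains the
      difference \<open>int l * int r - int \<epsilon>\<close>.\<close>
    then have "int m * int r * int l \<le> int lam + int s + int m * int \<epsilon>"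
      by (metis of_nat_add of_nat_le_iff of_nat_mult)
    then show False using bound by (simp add: algebra_simps)
  qed

  obtain v where v: "v \<in> bounded_End \<phi> lam" "v \<noteq> 0" and vE: "\<And>i. i \<in> {1..l} \<Longrightarrow> \<rho> i v ** E i = 0"
  proof -
    obtain W where W: "W \<subseteq> bounded_End \<phi> lam" "finite W" "?q ^ (m * r * \<epsilon>) < card W"
      using Fq.card_subspace_ge[OF subspace_bounded_End dim finite] by metis
    \<comment> \<open>Restricting to \<open>{1..l}\<close> makes \<open>F v\<close> an element of
      the finite product \<open>Pi\<^sub>E {1..l} R\<close>.\<close>
    define F where "F v = (\<lambda>i\<in>{1..l}. \<rho> i v ** E i)" for v
    define R where "R i = range (\<lambda>M. (M :: 'e ^ 'n ^ 'n) ** E i)" for i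
    have "card (F ` W) \<le> card (Pi\<^sub>E {1..l} R)"
      by (intro card_mono) (auto simp: F_def R_def intro!: finite_PiE)
    also have "\<dots> = (\<Prod>i=1..l. card (R i))"
      by (simp add: card_PiE)
    also have "\<dots> \<le> (\<Prod>i=1..l. CARD('e) ^ (CARD('n) * rank (E i)))"
      unfolding R_def by (intro prod_mono conjI card_matrix_multiples_le) simp
    \<comment> \<open>The factor \<open>r\<close> counts the rows of a matrix and \<open>m\<close>
      comes from \<open>CARD('e) = ?q ^ m\<close>.\<close>
    also have "\<dots> = ?q ^ (r * (m * (\<Sum>i=1..l. rank (E i))))"
      by (simp add: card_e r(1) sum_distrib_left mult.left_commute flip: power_sum power_mult)
    also have "\<dots> \<le> ?q ^ (m * r * \<epsilon>)"
      using errors q_gt_1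
      by (intro power_increasing) (simp_all add: mult_ac)
    also note W(3)
    finally have "\<not> inj_on F W" by (rule pigeonhole)
    then obtain v1 v2 where v12: "v1 \<in> W" "v2 \<in> W" "F v1 = F v2" "v1 \<noteq> v2"
      by (auto simp: inj_on_def)
    have v12': "v1 \<in> bounded_End \<phi> lam" "v2 \<in> bounded_End \<phi> lam" using v12 W(1) by auto
    show thesis
    proof
      \<comment> \<open>Two elements with the same image under \<open>F\<close> differ by a nonzero
        endomorphism annihilating all the errors from the left.\<close>
      show "v1 - v2 \<in> bounded_End \<phi> lam" using v12' by (rule bounded_End_diff)
      show "v1 - v2 \<noteq> 0" using v12(4) by simp
      show "\<rho> i (v1 - v2) ** E i = 0" if "i \<in> {1..l}" for i
        using fun_cong[OF v12(3), of i] that End[OF v12'(1)] End[OF v12'(2)]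
        by (simp add: F_def rho_diff matrix_diff_rdistrib)
    qed
  qed
  have "\<rho> i v ** Y i = \<rho> i (skew_mult ?q v u)" if "i \<in> {1..l}" for i
    using that vE[OF that] Y[OF that] End[OF v(1)] End[OF u]
    by (simp add: rho_mult matrix_add_ldistrib)
  then have "\<exists>v\<in>bounded_End \<phi> lam. \<exists>N\<in>bounded_End \<phi> (lam + s).
      (v, N) \<noteq> (0, 0) \<and> (\<forall>i\<in>{1..l}. \<rho> i v ** Y i = \<rho> i N)"
    using v bounded_End_skew_mult[OF v(1) u] by blast
  moreover have "N = skew_mult ?q v u \<and> v \<noteq> 0 \<and> is_right_quotient ?q N v u"
    if "v \<in> bounded_End \<phi> lam" "N \<in> bounded_End \<phi> (lam + s)"
      "(v, N) \<noteq> (0, 0)" "\<forall>i\<in>{1..l}. \<rho> i v ** Y i = \<rho> i N" for v N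
  proof -
    have N: "N = skew_mult ?q v u" using N_eq that by blast
    have "v \<noteq> 0"
    proof
      assume "v = 0"
      then have "N = 0"
        by (intro skew_poly_eqI) (simp add: N skew_eval_skew_mult)
      with \<open>v = 0\<close> that(3) show False by simp
    qed
    \<comment> \<open>Left cancellation by the nonzero \<open>v\<close> makes the right quotient
      unique.\<close>
    moreover have "w = u" if "skew_mult ?q v u = skew_mult ?q v w" for w
      using skew_mult_left_cancel[OF infinite_UNIV_alg_closed_field \<open>v \<noteq> 0\<close> that] by simp
    ultimately show ?thesis using N by (simp add: is_right_quotient_def)
  qed
  ultimately show ?thesis by blast
qed

end
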